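(* Let $f$ be a transcendental entire function of order strictly less than $1$ with $f(0)=1$, let $(z_n)_{n\ge1}$ be its (infinitely many) zeros, repeated according to multiplicity and numbered by increasing modulus, and let $n(r)=\#\{n\mid |z_n|\le r\}$ be the zero counting function. Then $$\mathcal E(\log\log|z_n|)=\limsup_{r\to\infty}\frac{\log n(r)}{\log\log\log r}.$$
   Context: For an entire function $f$ let $M_f(r)=\max_{|z|\le r}|f(z)|$; the order is $\rho_f=\inf\{a>0\mid \log M_f(r)\le r^a\text{ for all sufficiently large }r\}$. For a sequence $(w_n)$ with $|w_n|\to\infty$ (defined for sufficiently large $n$) the exponent of convergence is $\mathcal E(w_n)=\inf\{a>0\mid\sum_{n\ge n^*}|w_n|^{-a}<\infty\}$ ($\inf\emptyset=\infty$), where $n^*$ is such that $w_n$ is defined and $|w_n|>0$ for $n\ge n^*$. *)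

theory Defs
  imports "HOL-Complex_Analysis.Complex_Analysis" "HOL-Computational_Algebra.Polynomial"
begin

definition transcendental_entire :: "(complex \<Rightarrow> complex) \<Rightarrow> bool" where
  "transcendental_entire f \<longleftrightarrow> f holomorphic_on UNIV \<and> \<not> (\<exists>p. \<forall>z. f z = poly p z)"

(* For continuous f and r >= 0 the supremum is attained. *)
definition max_modulus :: "(complex \<Rightarrow> complex) \<Rightarrow> real \<Rightarrow> real" where
  "max_modulus f r = (SUP z\<in>cball 0 r. norm (f z))"

definition order_of_growth :: "(complex \<Rightarrow> complex) \<Rightarrow> ereal" where
  "order_of_growth f =
     Inf {ereal a | a. a > 0 \<and> (\<forall>\<^sub>F r in at_top. ln (max_modulus f r) \<le> r powr a)}"

(* Intended for sequences whose norm tends to infinity. The index N plays the role of n*: only a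
   tail of w on which w does not vanish matters, so values of w at finitely many indices (where
   the expression defining w may be meaningless) are irrelevant. Inf {} = infinity in ereal. *)
definition exponent_of_convergence :: "(nat \<Rightarrow> 'a::real_normed_vector) \<Rightarrow> ereal" where
  "exponent_of_convergence w =
     Inf {ereal a | a. a > 0 \<and>
       (\<exists>N. (\<forall>n\<ge>N. norm (w n) > 0) \<and> summable (\<lambda>n. norm (w (n + N)) powr (- a)))}"

(* z lists exactly the zeros of f, each as often as its multiplicity, by increasing modulus.
   Indices start at 0 rather than 1. At a zero of an entire f that is not identically 0,
   zorder is the (positive) multiplicity, so that {n. z n = w} is then finite and nonempty. *)
definition enumerates_zeros :: "(complex \<Rightarrow> complex) \<Rightarrow> (nat \<Rightarrow> complex) \<Rightarrow> bool" where
  "enumerates_zeros f z \<longleftrightarrow>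
     (\<forall>n. f (z n) = 0) \<and>
     (\<forall>w. f w = 0 \<longrightarrow> int (card {n. z n = w}) = zorder f w) \<and>
     incseq (\<lambda>n. norm (z n))"

definition counting_function :: "(nat \<Rightarrow> complex) \<Rightarrow> real \<Rightarrow> nat" where
  "counting_function z r = card {n. norm (z n) \<le> r}"

end

(* If f had finitely many zeros, it would be P * exp g with P a polynomial and g entire. Since
   |P| >= 1 far out, order < 1 gives Re (g z) <= |z|^a + O(1) with a < 1; the Schwarz lemma, applied
   to u / (2A - u) for u = g - g(w) on discs around w of growing radius, forces g' = 0, so f would
   be a polynomial.

   For the formula write u_n = ln ln |z_n| and t = ln ln r. If the sum of u_n^(-a) converges to S,
   then the terms with |z_n| <= r are at least t^(-a) each, so n(r) <= S t^a + O(1). Conversely,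
   if n(r) <= t^b for large r, then r = |z_n| gives n <= u_n^b, so u_n^(-c) <= n^(-c/b) is summable
   for each c > b. *)

theory Submission imports Defs "HOL-Real_Asymp.Real_Asymp" begin

section \<open>Entire functions whose real part grows sublinearly\<close>

text \<open>A Borel-Caratheodory estimate for the derivative. A point of the half-plane
  \<open>Re u < A\<close> is closer to 0 than to \<open>2 * A\<close>, so u / (2A - u) maps this
  half-plane into the unit disc and fixes 0.\<close>

lemma norm_deriv_le_of_Re_less:
  fixes g :: "complex \<Rightarrow> complex"
  assumes hol: "g holomorphic_on ball w R" and "R > 0" "A > 0"
    and less: "\<And>z. z \<in> ball w R \<Longrightarrow> Re (g z - g w) < A"
  shows "norm (deriv g w) \<le> 2 * A / R"
proof -
  define u where "u = (\<lambda>x. g (w + of_real R * x) - g w)"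
  define \<phi> where "\<phi> = (\<lambda>x. u x / (of_real (2 * A) - u x))"
  have mem: "w + of_real R * x \<in> ball w R" if "norm x < 1" for x
    using that \<open>R > 0\<close> by (simp add: dist_norm norm_mult)
  have Re_u: "Re (u x) < A" if "norm x < 1" for x
    using less[OF mem[OF that]] by (simp add: u_def)
  have nz: "of_real (2 * A) - u x \<noteq> 0" if "norm x < 1" for x
    using Re_u[OF that] \<open>A > 0\<close> by (auto simp: complex_eq_iff)
  have "u holomorphic_on ball 0 1"
    unfolding u_def
    by (intro holomorphic_intros holomorphic_on_compose_gen[OF _ hol, unfolded o_def])
       (use mem in auto)
  then have hol\<phi>: "\<phi> holomorphic_on ball 0 1"
    unfolding \<phi>_def by (intro holomorphic_intros) (use nz in auto)
  have lt1: "norm (\<phi> x) < 1" if "norm x < 1" for x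
  proof -
    have "(norm (u x))\<^sup>2 < (norm (of_real (2 * A) - u x))\<^sup>2"
    proof -
      have "(norm (of_real (2 * A) - u x))\<^sup>2 - (norm (u x))\<^sup>2 = 4 * A * (A - Re (u x))"
        unfolding cmod_power2 by (simp add: power2_eq_square algebra_simps)
      moreover have "4 * A * (A - Re (u x)) > 0"
        using \<open>A > 0\<close> Re_u[OF that] by simp
      ultimately show ?thesis by linarith
    qed
    then have "norm (u x) < norm (of_real (2 * A) - u x)"
      by (rule power2_less_imp_less) simp
    then show ?thesis
      using nz[OF that] by (simp add: \<phi>_def norm_divide)
  qed
  have "norm (deriv \<phi> 0) \<le> 1"
    using Schwarz_Lemma'[OF hol\<phi> _ lt1] by (simp add: \<phi>_def u_def)
  \<comment> \<open>The Moebius map has derivative 1 / (2A) at 0; rescaling the disc to radius 1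
    contributes the factor \<open>R\<close>.\<close>
  moreover have "deriv \<phi> 0 = of_real R * deriv g w / of_real (2 * A)"
  proof -
    have g': "(g has_field_derivative deriv g w) (at (w + of_real R * 0))"
      using holomorphic_derivI[OF hol, of w] \<open>R > 0\<close> by simp
    have "((\<lambda>x. w + of_real R * x) has_field_derivative of_real R) (at 0)"
      by (auto intro!: derivative_eq_intros)
    from DERIV_chain2[where f = g and g = "\<lambda>x. w + of_real R * x", OF g' this]
    have "(u has_field_derivative of_real R * deriv g w) (at 0)"
      unfolding u_def by (auto intro!: derivative_eq_intros)
    moreover have "u 0 = 0" by (simp add: u_def)
    ultimately have "(\<phi> has_field_derivative of_real R * deriv g w / of_real (2 * A)) (at 0)"
      unfolding \<phi>_def using \<open>A > 0\<close>
      by (auto intro!: derivative_eq_intros simp: field_simps)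
    then show ?thesis by (rule DERIV_imp_deriv)
  qed
  ultimately show ?thesis
    using \<open>R > 0\<close> \<open>A > 0\<close> by (simp add: norm_mult norm_divide field_simps)
qed

text \<open>On the disc of radius \<open>R\<close> about \<open>w\<close> the derivative estimate is
  O(R^(a-1)), which tends to 0 because \<open>a < 1\<close>.\<close>

lemma entire_Re_sublinear_constant:
  fixes g :: "complex \<Rightarrow> complex"
  assumes hol: "g holomorphic_on UNIV" and a: "0 < a" "a < 1"
    and le: "\<And>z. Re (g z) \<le> norm z powr a + C"
  shows "\<exists>c. \<forall>z. g z = c"
proof -
  have "deriv g w = 0" for w
  proof -
    \<comment> \<open>\<open>B\<close> absorbs \<open>C\<close> and \<open>- Re (g w)\<close>; the
      summand 1 makes the bound positive and the inequality strict.\<close>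
    define B where "B = \<bar>C\<bar> + norm (g w) + 1"
    have bd: "norm (deriv g w) \<le> 2 * ((norm w + R) powr a + B) / R" if "R > 0" for R
    proof (rule norm_deriv_le_of_Re_less)
      show "g holomorphic_on ball w R" using hol holomorphic_on_subset by blast
      show "0 < (norm w + R) powr a + B"
        unfolding B_def by (intro add_nonneg_pos powr_ge_zero) (auto intro: add_nonneg_pos)
      fix z assume "z \<in> ball w R"
      then have "norm z \<le> norm w + R"
        using norm_triangle_ineq2[of z w] by (simp add: dist_norm norm_minus_commute)
      then have "norm z powr a \<le> (norm w + R) powr a"
        using a by (intro powr_mono2) auto
      moreover have "- Re (g w) \<le> norm (g w)"
        using abs_Re_le_cmod[of "g w"] by linarith
      ultimately show "Re (g z - g w) < (norm w + R) powr a + B"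
        using le[of z] by (simp add: B_def)
    qed fact
    have "((\<lambda>R. 2 * ((norm w + R) powr a + B) / R) \<longlongrightarrow> 0) at_top"
      using a by real_asymp
    moreover have "\<forall>\<^sub>F R in at_top. norm (deriv g w) \<le> 2 * ((norm w + R) powr a + B) / R"
      using eventually_gt_at_top[of 0] by eventually_elim (rule bd)
    ultimately have "norm (deriv g w) \<le> 0"
      by (intro tendsto_lowerbound) auto
    then show ?thesis by simp
  qed
  then have "(g has_field_derivative 0) (at w)" for w
    using holomorphic_derivI[OF hol open_UNIV, of w] by simp
  then show ?thesis
    using has_field_derivative_zero_constant[of UNIV g] by auto
qed

section \<open>Factoring an entire function with finitely many zeros\<close>

lemma zorder_prod_linear_powers:
  fixes Z :: "complex set"
  assumes "finite Z" "w \<in> Z" "k w > 0"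
  shows "zorder (\<lambda>x. \<Prod>v\<in>Z. (x - v) ^ k v) w = int (k w)"
proof (rule zorder_eqI)
  show "(\<lambda>x. \<Prod>v\<in>Z - {w}. (x - v) ^ k v) holomorphic_on UNIV"
    by (intro holomorphic_intros)
  show "(\<Prod>v\<in>Z - {w}. (w - v) ^ k v) \<noteq> 0"
    using assms by simp
  show "(\<Prod>v\<in>Z. (x - v) ^ k v) = (\<Prod>v\<in>Z - {w}. (x - v) ^ k v) * (x - w) powi int (k w)" for x
    using assms prod.remove[of Z w "\<lambda>v. (x - v) ^ k v"] by (simp add: mult.commute)
qed auto

text \<open>The identity theorem on the connected plane, in the form of the side condition of
  \<open>zorder_pos_iff\<close>.\<close>

lemma frequently_nonzero_of_entire:
  fixes f :: "complex \<Rightarrow> complex"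
  assumes "f holomorphic_on UNIV" "f y \<noteq> 0"
  shows "\<exists>\<^sub>F z in at w. f z \<noteq> 0"
proof -
  have "\<forall>\<^sub>F z in at w. f z \<noteq> 0 \<and> z \<in> UNIV"
    by (rule non_zero_neighbour_alt[OF assms(1)]) (use assms in \<open>auto simp: connected_UNIV\<close>)
  then show ?thesis
    by (intro eventually_frequently) (auto elim: eventually_mono)
qed

text \<open>The polynomial \<open>P\<close> has the same zeros as \<open>f\<close> with the same
  orders, so the quotient is entire and zero-free, hence has a holomorphic logarithm on the
  plane.\<close>

lemma entire_finite_zeros_factorization:
  fixes f :: "complex \<Rightarrow> complex"
  assumes hol: "f holomorphic_on UNIV" and "f y \<noteq> 0" and fin: "finite {w. f w = 0}"
  obtains g k where "g holomorphic_on UNIV"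
    "\<And>z. f z = exp (g z) * (\<Prod>v | f v = 0. (z - v) ^ k v)"
proof -
  \<comment> \<open>\<open>nat\<close> loses nothing at the zeros of \<open>f\<close>, where the
    order is positive.\<close>
  define k where "k = (\<lambda>v. nat (zorder f v))"
  define P where "P = (\<lambda>z. \<Prod>v | f v = 0. (z - v) ^ k v)"
  have pos: "zorder f v > 0" if "f v = 0" for v
    using zorder_pos_iff[OF hol] frequently_nonzero_of_entire[OF hol \<open>f y \<noteq> 0\<close>] that by auto
  have P0: "P z = 0 \<longleftrightarrow> f z = 0" for z
    using fin pos by (auto simp: P_def k_def)
  have holP: "P holomorphic_on UNIV" unfolding P_def by (intro holomorphic_intros)
  have "zorder P z = zorder f z" for z
  proof (cases "f z = 0")
    case True
    then show ?thesis
      unfolding P_def using zorder_prod_linear_powers[OF fin, of z k] pos[OF True]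
      by (simp add: k_def)
  next
    case False
    then have "P z \<noteq> 0" using P0 by simp
    then show ?thesis
      using False hol holP zorder_eq_0I analytic_at open_UNIV UNIV_I by metis
  qed
  then obtain h where h: "h holomorphic_on UNIV" "\<And>z. h z \<noteq> 0" "\<And>z. f z = h z * P z"
    using holomorphic_zorder_factorization[OF hol open_UNIV connected_UNIV holP] P0 by auto
  then obtain g where g: "g holomorphic_on UNIV" "\<And>z. exp (g z) = h z"
    using holomorphic_logarithm_exists[of UNIV h 0] by auto
  have "f z = exp (g z) * (\<Prod>v | f v = 0. (z - v) ^ k v)" for z
    using h(3)[of z] unfolding g(2) P_def .
  with g(1) show thesis by (rule that)
qed

section \<open>Order less than 1 forces infinitely many zeros\<close>

lemma norm_le_max_modulus:
  assumes "f holomorphic_on UNIV"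
  shows "norm (f z) \<le> max_modulus f (norm z)"
  unfolding max_modulus_def
proof (rule cSUP_upper)
  have "continuous_on (cball 0 (norm z)) (\<lambda>x. norm (f x))"
    using assms holomorphic_on_imp_continuous_on holomorphic_on_subset
    by (intro continuous_on_norm) blast
  then show "bdd_above ((\<lambda>x. norm (f x)) ` cball 0 (norm z))"
    by (intro bounded_imp_bdd_above compact_imp_bounded compact_continuous_image) auto
qed auto

lemma infinite_zeros_of_order_less_1:
  assumes tr: "transcendental_entire f" and ord: "order_of_growth f < 1"
  shows "infinite {w. f w = 0}"
proof
  assume fin: "finite {w. f w = 0}"
  have hol: "f holomorphic_on UNIV" and npoly: "\<And>p. \<not> (\<forall>z. f z = poly p z)"
    using tr by (auto simp: transcendental_entire_def)
  obtain y where "f y \<noteq> 0" using npoly[of 0] by auto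
  then obtain g k where g: "g holomorphic_on UNIV"
    and fg: "\<And>z. f z = exp (g z) * (\<Prod>v | f v = 0. (z - v) ^ k v)"
    using entire_finite_zeros_factorization[OF hol _ fin] by metis
  obtain a where a: "0 < a" "a < 1"
    and ev: "\<forall>\<^sub>F r in at_top. ln (max_modulus f r) \<le> r powr a"
    using ord unfolding order_of_growth_def Inf_less_iff by (auto simp: one_ereal_def)
  obtain r0 where r0: "\<And>r. r \<ge> r0 \<Longrightarrow> ln (max_modulus f r) \<le> r powr a"
    using ev unfolding eventually_at_top_linorder by blast
  obtain b where b: "\<And>v. f v = 0 \<Longrightarrow> norm v \<le> b"
    using finite_imp_bounded[OF fin] by (auto simp: bounded_iff)
  \<comment> \<open>Beyond \<open>r0\<close> the growth bound holds; beyond \<open>b + 1\<close>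
    every zero is at distance at least 1, so each linear factor has modulus at least 1.\<close>
  define r1 where "r1 = max r0 (b + 1)"
  have outer: "Re (g z) \<le> norm z powr a" if z: "norm z \<ge> r1" for z
  proof -
    have "1 \<le> norm (\<Prod>v | f v = 0. (z - v) ^ k v)"
      unfolding prod_norm[symmetric] norm_power
    proof (intro prod_ge_1 one_le_power)
      fix v assume "v \<in> {v. f v = 0}"
      then show "1 \<le> norm (z - v)"
        using b[of v] z norm_triangle_ineq2[of z v] by (auto simp: r1_def)
    qed
    then have "exp (Re (g z)) \<le> norm (f z)"
      by (subst fg) (simp add: norm_mult)
    also have "\<dots> \<le> max_modulus f (norm z)" by (rule norm_le_max_modulus[OF hol])
    finally have "Re (g z) \<le> ln (max_modulus f (norm z))"
      by (metis exp_gt_zero less_le_trans ln_exp ln_le_cancel_iff)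
    also have "\<dots> \<le> norm z powr a" using r0 z by (simp add: r1_def)
    finally show ?thesis .
  qed
  have "bounded (g ` cball 0 r1)"
    using g holomorphic_on_imp_continuous_on holomorphic_on_subset
    by (intro compact_imp_bounded compact_continuous_image) auto
  then obtain C where C: "\<And>z. norm z \<le> r1 \<Longrightarrow> norm (g z) \<le> C"
    unfolding bounded_iff by force
  \<comment> \<open>The absolute value keeps the constant nonnegative, so that one bound serves both
    inside and outside the disc.\<close>
  have "Re (g z) \<le> norm z powr a + \<bar>C\<bar>" for z
  proof (cases "norm z \<ge> r1")
    case True
    then show ?thesis using outer[of z] by linarith
  next
    case False
    then have "Re (g z) \<le> C" using C[of z] complex_Re_le_cmod[of "g z"] by linarith
    moreover have "norm z powr a \<ge> 0" by simp
    ultimately show ?thesis by linarith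
  qed
  then obtain c where "\<And>z. g z = c" using entire_Re_sublinear_constant[OF g a] by blast
  then have "f z = poly (smult (exp c) (\<Prod>v | f v = 0. [:-v, 1:] ^ k v)) z" for z
    by (subst fg) (simp add: poly_prod)
  then show False using npoly by blast
qed

section \<open>Moduli of the enumerated zeros\<close>

text \<open>A disc contains finitely many zeros, each listed finitely often, so some term leaves it;
  monotonicity keeps all later terms outside.\<close>

lemma norm_enumerates_zeros_at_top:
  assumes hol: "f holomorphic_on UNIV" and "f y \<noteq> 0" and en: "enumerates_zeros f z"
  shows "filterlim (\<lambda>n. norm (z n)) at_top sequentially"
proof -
  have z0: "f (z n) = 0" and card: "f w = 0 \<Longrightarrow> int (card {n. z n = w}) = zorder f w"
    and inc: "incseq (\<lambda>n. norm (z n))" for n w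
    using en by (auto simp: enumerates_zeros_def)
  have finr: "finite {n. norm (z n) \<le> r}" for r
  proof -
    have "finite {w \<in> cball 0 r. f w = 0}"
    proof (rule holomorphic_compact_finite_zeros[OF hol])
      show "\<not> f constant_on UNIV"
        using z0[of 0] \<open>f y \<noteq> 0\<close> by (metis UNIV_I constant_on_def)
    qed (auto simp: connected_UNIV)
    moreover have "finite {n. z n = w}" if "f w = 0" for w
    proof -
      have "zorder f w > 0"
        using zorder_pos_iff[OF hol] frequently_nonzero_of_entire[OF hol \<open>f y \<noteq> 0\<close>] that by auto
      \<comment> \<open>An infinite set has \<open>card\<close> equal to 0, so positivity yields
        finiteness.\<close>
      then have "card {n. z n = w} > 0" using card[OF that] by linarith
      then show ?thesis using card_gt_0_iff by blast
    qed
    ultimately have "finite (\<Union>w\<in>{w \<in> cball 0 r. f w = 0}. {n. z n = w})" by blast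
    then show ?thesis by (rule finite_subset[rotated]) (use z0 in auto)
  qed
  show ?thesis
    unfolding filterlim_at_top_dense
  proof
    fix r
    have "{n. norm (z n) \<le> r} \<noteq> UNIV" using finr[of r] by (metis infinite_UNIV_nat)
    then obtain N where "norm (z N) > r" using not_le by blast
    then show "\<forall>\<^sub>F n in sequentially. norm (z n) > r"
      using inc unfolding eventually_sequentially by (meson incseqD less_le_trans)
  qed
qed

text \<open>Ensures that \<open>counting_function\<close> really counts, rather than returning the
  default 0 of \<open>card\<close> on infinite sets.\<close>

lemma finite_norm_le_of_filterlim:
  fixes z :: "nat \<Rightarrow> 'a::real_normed_vector"
  assumes "filterlim (\<lambda>n. norm (z n)) at_top sequentially"
  shows "finite {n. norm (z n) \<le> r}"
proof -
  have "\<forall>\<^sub>F n in sequentially. norm (z n) > r"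
    using assms by (simp add: filterlim_at_top_dense)
  then obtain L where "\<And>n. n \<ge> L \<Longrightarrow> norm (z n) > r"
    unfolding eventually_sequentially by blast
  then have "{n. norm (z n) \<le> r} \<subseteq> {..<L}" by (force simp: not_le)
  then show ?thesis using finite_subset by blast
qed

section \<open>Counting function and exponent of convergence\<close>

text \<open>The bound K t^a with t = ln ln r becomes ln K + a ln t on taking logarithms, and
  division by ln t removes the constant in the limit.\<close>

lemma Limsup_counting_function_le:
  assumes lim: "filterlim (\<lambda>n. norm (z n)) at_top sequentially" and a: "a > 0"
    and sm: "summable (\<lambda>n. norm (ln (ln (norm (z (n + N))))) powr - a)"
  shows "Limsup at_top (\<lambda>r. ereal (ln (real (counting_function z r)) / ln (ln (ln r)))) \<le> ereal a"
proof -
  define g where "g = (\<lambda>n. norm (ln (ln (norm (z n)))) powr - a)"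
  define S where "S = suminf g"
  have sg: "summable g" using sm summable_iff_shift[of g N] by (simp add: g_def)
  have S0: "S \<ge> 0" unfolding S_def by (rule suminf_nonneg[OF sg]) (simp add: g_def)
  \<comment> \<open>Beyond e the iterated logarithm is positive, so its \<open>norm\<close> is its
    value and the power with exponent \<open>- a\<close> is antitone.\<close>
  obtain M where M: "\<And>n. n \<ge> M \<Longrightarrow> norm (z n) > exp 1"
    using lim unfolding filterlim_at_top_dense eventually_sequentially by blast
  \<comment> \<open>\<open>M\<close> counts the early indices and \<open>S\<close> bounds the rest;
    the summand 1 gives \<open>K \<ge> 1\<close>, so \<open>ln K\<close> is nonnegative.\<close>
  define K where "K = real M + S + 1"
  have count: "real (counting_function z r) \<le> K * ln (ln r) powr a"
    if r: "ln (ln r) \<ge> 1" "r > exp 1" for r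
  proof -
    define t where "t = ln (ln r)"
    define B where "B = {n. n \<ge> M \<and> norm (z n) \<le> r}"
    have "finite B"
      using finite_norm_le_of_filterlim[OF lim, of r] by (rule finite_subset[rotated]) (auto simp: B_def)
    have "counting_function z r \<le> card ({..<M} \<union> B)"
      unfolding counting_function_def using \<open>finite B\<close> by (intro card_mono) (auto simp: B_def)
    also have "\<dots> \<le> M + card B" using card_Un_le[of "{..<M}" B] by simp
    finally have c1: "real (counting_function z r) \<le> real M + real (card B)" by linarith
    have "real (card B) * t powr - a = (\<Sum>n\<in>B. t powr - a)" by simp
    also have "\<dots> \<le> sum g B"
    proof (rule sum_mono)
      fix n assume n: "n \<in> B"
      then have 1: "exp 1 < norm (z n)" "norm (z n) \<le> r" using M by (auto simp: B_def)
      then have p: "norm (z n) > 0" using exp_gt_zero less_trans by blast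
      have "1 < ln (norm (z n))" using 1 p by (metis exp_less_cancel_iff exp_ln)
      moreover have "ln (norm (z n)) \<le> ln r" using 1 p by (simp add: ln_mono)
      ultimately have "0 < ln (ln (norm (z n)))" "ln (ln (norm (z n))) \<le> t"
        by (auto simp: t_def ln_mono)
      then show "t powr - a \<le> g n"
        using a by (auto simp: g_def intro!: powr_mono2')
    qed
    also have "\<dots> \<le> S" unfolding S_def
      by (rule sum_le_suminf[OF sg \<open>finite B\<close>]) (simp add: g_def)
    finally have c2: "real (card B) \<le> S * t powr a"
      using r by (simp add: powr_minus field_simps t_def)
    \<comment> \<open>This lets the multiple of t^a absorb the constant \<open>M\<close>.\<close>
    have "1 \<le> t powr a" using r a by (intro ge_one_powr_ge_zero) (auto simp: t_def)
    then have "real M + S * t powr a \<le> K * t powr a"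
      using mult_left_mono[of 1 "t powr a" "real M"] by (simp add: K_def algebra_simps)
    then show ?thesis using c1 c2 by (simp add: t_def)
  qed
  have "\<forall>\<^sub>F r in at_top. ln (real (counting_function z r)) / ln (ln (ln r)) \<le> ln K / ln (ln (ln r)) + a"
  proof -
    have "\<forall>\<^sub>F r::real in at_top. ln (ln r) > 1" "\<forall>\<^sub>F r::real in at_top. r > exp 1"
      by real_asymp+
    then show ?thesis
    proof eventually_elim
      case (elim r)
      define t where "t = ln (ln r)"
      have t: "t > 1" using elim by (simp add: t_def)
      have K1: "K \<ge> 1" using S0 by (simp add: K_def)
      have c: "real (counting_function z r) \<le> K * t powr a" using count elim by (simp add: t_def)
      have "ln (real (counting_function z r)) \<le> ln K + a * ln t"
      proof (cases "counting_function z r = 0")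
        \<comment> \<open>Here \<open>ln 0\<close> is 0 by convention, and the right side is
          nonnegative.\<close>
        case True
        then show ?thesis using K1 t a by simp
      next
        case False
        then have "ln (real (counting_function z r)) \<le> ln (K * t powr a)" using c by (simp add: ln_mono)
        also have "\<dots> = ln K + a * ln t" using K1 t by (simp add: ln_mult ln_powr)
        finally show ?thesis .
      qed
      then show ?case using t by (simp add: t_def field_simps)
    qed
  qed
  then have "Limsup at_top (\<lambda>r. ereal (ln (real (counting_function z r)) / ln (ln (ln r))))
      \<le> Limsup at_top (\<lambda>r. ereal (ln K / ln (ln (ln r)) + a))"
    by (intro Limsup_mono) simp
  also have "((\<lambda>r. ln K / ln (ln (ln r)) + a) \<longlongrightarrow> a) at_top" by real_asymp
  then have "Limsup at_top (\<lambda>r. ereal (ln K / ln (ln (ln r)) + a)) = ereal a"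
    by (intro lim_imp_Limsup) auto
  finally show ?thesis .
qed

text \<open>As moduli increase, every index up to \<open>n\<close> is counted at radius |z_n|. The
  gap between \<open>b\<close> and \<open>c\<close> makes the comparison series converge, its
  exponent c / b exceeding 1.\<close>

lemma summable_of_Limsup_counting_function_less:
  assumes lim: "filterlim (\<lambda>n. norm (z n)) at_top sequentially" and inc: "incseq (\<lambda>n. norm (z n))"
    and b: "0 < b" "b < c"
    and less: "Limsup at_top (\<lambda>r. ereal (ln (real (counting_function z r)) / ln (ln (ln r)))) < ereal b"
  shows "summable (\<lambda>n. norm (ln (ln (norm (z n)))) powr - c)"
proof (rule summable_comparison_test_ev)
  show "summable (\<lambda>n. real n powr - (c / b))"
    using b by (simp add: summable_real_powr_iff)
  have ev: "\<forall>\<^sub>F r in at_top. ln (real (counting_function z r)) / ln (ln (ln r)) < b"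
    using Limsup_lessD[OF less] by simp
  have "\<forall>\<^sub>F r::real in at_top. ln (ln r) > 1" by real_asymp
  with ev have "\<forall>\<^sub>F r in at_top.
      ln (ln r) > 1 \<and> ln (real (counting_function z r)) < b * ln (ln (ln r))"
    by eventually_elim (simp add: field_simps)
  then have "\<forall>\<^sub>F n in sequentially. ln (ln (norm (z n))) > 1 \<and>
      ln (real (counting_function z (norm (z n)))) < b * ln (ln (ln (norm (z n))))"
    using lim by (rule eventually_compose_filterlim)
  then show "\<forall>\<^sub>F n in sequentially.
      norm (norm (ln (ln (norm (z n)))) powr - c) \<le> real n powr - (c / b)"
    using eventually_gt_at_top[of 0]
  proof eventually_elim
    case (elim n)
    define u where "u = ln (ln (norm (z n)))"
    have u: "u > 1" using elim by (simp add: u_def)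
    \<comment> \<open>Indices start at 0, so \<open>{..n}\<close> has n + 1 elements; the weaker
      bound by \<open>n\<close> suffices, with \<open>n > 0\<close> keeping its logarithm and
      negative power meaningful.\<close>
    have "card {..n} \<le> counting_function z (norm (z n))"
      unfolding counting_function_def using inc finite_norm_le_of_filterlim[OF lim]
      by (intro card_mono) (auto simp: incseq_def)
    then have "ln (real n) \<le> ln (real (counting_function z (norm (z n))))"
      using elim by (intro ln_mono) auto
    also have "\<dots> \<le> b * ln u" using elim by (simp add: u_def)
    also have "\<dots> = ln (u powr b)" using u by (simp only: ln_powr)
    finally have "real n \<le> u powr b"
      using elim u by (subst (asm) ln_le_cancel_iff) auto
    then have "(u powr b) powr - (c / b) \<le> real n powr - (c / b)"
      using elim b by (intro powr_mono2') auto
    then show ?case using b u by (simp add: powr_powr u_def)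
  qed
qed

text \<open>A fact about sequences alone: zeros of entire functions enter later, through the two
  assumptions.\<close>

lemma exponent_of_convergence_eq_Limsup_counting_function:
  assumes lim: "filterlim (\<lambda>n. norm (z n)) at_top sequentially" and inc: "incseq (\<lambda>n. norm (z n))"
  shows "exponent_of_convergence (\<lambda>n. ln (ln (norm (z n)))) =
    Limsup at_top (\<lambda>r. ereal (ln (real (counting_function z r)) / ln (ln (ln r))))"
    (is "?E = ?L")
proof (rule antisym)
  \<comment> \<open>A nonnegative limsup makes the \<open>b\<close> chosen below positive.\<close>
  have "\<forall>\<^sub>F r::real in at_top. ln (ln (ln r)) > 0" by real_asymp
  then have "\<forall>\<^sub>F r in at_top. 0 \<le> ereal (ln (real (counting_function z r)) / ln (ln (ln r)))"
  proof eventually_elim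
    case (elim r)
    have "ln (real m) \<ge> 0" for m by (cases m) auto
    then show ?case using elim by simp
  qed
  then have L0: "0 \<le> ?L" by (intro le_Limsup) auto
  show "?E \<le> ?L"
  proof (rule ccontr)
    assume "\<not> ?E \<le> ?L"
    \<comment> \<open>Two reals fit into the gap: \<open>b\<close> bounds the growth of the counting
      function, and then the larger \<open>c\<close> is an admissible exponent below the
      infimum.\<close>
    then obtain b where b: "?L < ereal b" "ereal b < ?E" using ereal_dense2[of ?L ?E] by (auto simp: not_le)
    then obtain c where c: "ereal b < ereal c" "ereal c < ?E"
      using ereal_dense2[of "ereal b" ?E] by auto
    have "0 < b" using L0 b by (metis ereal_less(2) le_less_trans)
    have "b < c" using c by simp
    have sm: "summable (\<lambda>n. norm (ln (ln (norm (z n)))) powr - c)"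
      using summable_of_Limsup_counting_function_less[OF lim inc \<open>0 < b\<close> \<open>b < c\<close> b(1)] .
    have "\<forall>\<^sub>F r::real in at_top. 0 < ln (ln r)" by real_asymp
    then have "\<forall>\<^sub>F n in sequentially. ln (ln (norm (z n))) > 0"
      using lim by (rule eventually_compose_filterlim)
    then obtain N where "\<And>n. n \<ge> N \<Longrightarrow> norm (ln (ln (norm (z n)))) > 0"
      unfolding eventually_sequentially by force
    then have "?E \<le> ereal c"
      unfolding exponent_of_convergence_def
      using \<open>0 < b\<close> \<open>b < c\<close> summable_ignore_initial_segment[OF sm, of N]
      by (intro Inf_lower) force
    then show False using c by simp
  qed
  \<comment> \<open>Each admissible exponent bounds the limsup; if there is none, the infimum is
    infinite.\<close>
  show "?L \<le> ?E"
    unfolding exponent_of_convergence_def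
    by (rule Inf_greatest) (use Limsup_counting_function_le[OF lim] in blast)
qed

theorem proposition8p2:
  fixes f :: "complex \<Rightarrow> complex"
  assumes "transcendental_entire f"
    and "order_of_growth f < 1"
    and "f 0 = 1"
  shows "infinite {w. f w = 0} \<and>
    (\<forall>z. enumerates_zeros f z \<longrightarrow>
      exponent_of_convergence (\<lambda>n. ln (ln (norm (z n)))) =
      Limsup at_top (\<lambda>r::real. ereal (ln (real (counting_function z r)) / ln (ln (ln r)))))"
proof (intro conjI allI impI)
  show "infinite {w. f w = 0}" using infinite_zeros_of_order_less_1 assms by blast
  fix z assume en: "enumerates_zeros f z"
  have "f holomorphic_on UNIV" using assms by (simp add: transcendental_entire_def)
  \<comment> \<open>The normalization at 0 supplies the point where \<open>f\<close> does not
    vanish.\<close>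
  then have "filterlim (\<lambda>n. norm (z n)) at_top sequentially"
    using norm_enumerates_zeros_at_top[of f 0 z] assms en by simp
  then show "exponent_of_convergence (\<lambda>n. ln (ln (norm (z n)))) =
      Limsup at_top (\<lambda>r::real. ereal (ln (real (counting_function z r)) / ln (ln (ln r))))"
    using en by (intro exponent_of_convergence_eq_Limsup_counting_function)
      (auto simp: enumerates_zeros_def)
qed

end
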